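(* Let $G$ be a locally compact group and let $E\subseteq G$ be a cb-Helson set. Suppose there exist closed abelian subgroups $H_1,\dots,H_m$ of $G$ and elements $y_1,\dots,y_m\in G$ such that $E\subseteq\bigcup_{i=1}^m y_iH_i$. Then $E$ is finite.
   Context: For a locally compact group $G$, let $\lambda$ be the left regular representation on $L^2(G)$ and let $\mathrm{VN}(G)\subseteq \mathcal{B}(L^2(G))$ be the von Neumann algebra generated by $\lambda(G)$. The Fourier algebra $\mathrm{A}(G)$ is the algebra (under pointwise operations) of functions on $G$ of the form $s\mapsto \langle \lambda(s)\xi,\eta\rangle$ with $\xi,\eta\in L^2(G)$, identified with the predual of $\mathrm{VN}(G)$ via $\langle f,\lambda(s)\rangle = f(s)$. It carries the predual norm and the canonical operator space structure it inherits as the predual of $\mathrm{VN}(G)$. For a closed subset $E\subseteq G$, let $I_E$ be the ideal of functions in $\mathrm{A}(G)$ that vanish on $E$, and let $\mathrm{A}_G(E)=\mathrm{A}(G)/I_E$, equipped with the quotient norm and the quotient operator space structure. Let $\imath_E:\mathrm{A}_G(E)\to C_0(E)$ be the canonical inclusion map (induced by restriction of functions to $E$), which is injective with dense range. A closed subset $E\subseteq G$ is a cb-Helson set if $\imath_E$ is surjective and $\imath_E^{-1}:\min C_0(E)\to \mathrm{A}_G(E)$ is completely bounded, where $\min C_0(E)$ denotes $C_0(E)$ with its minimal operator space structure (the one it has as a commutative $C^*$-algebra). *)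

theory Defs
  imports "HOL-Analysis.Analysis"
begin

text \<open>
  Groups are types of class \<^class>\<open>topological_group_add\<close>. This class is written additively but does
  not assume commutativity: \<open>x + y\<close> is the group product, \<open>- x\<close> the inverse, \<open>0\<close> the identity.
\<close>

definition add_subgroup :: "'g::group_add set \<Rightarrow> bool" where
  "add_subgroup H \<longleftrightarrow> 0 \<in> H \<and> (\<forall>x\<in>H. \<forall>y\<in>H. x + y \<in> H) \<and> (\<forall>x\<in>H. - x \<in> H)"

definition abelian_subgroup :: "'g::group_add set \<Rightarrow> bool" where
  "abelian_subgroup H \<longleftrightarrow> add_subgroup H \<and> (\<forall>x\<in>H. \<forall>y\<in>H. x + y = y + x)"

text \<open>
  \<open>G\<close> need not be \<open>\<sigma>\<close>-compact; the Radon conditions are outer regularity on Borel sets and inner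
  regularity on open sets.
\<close>

definition left_haar_measure :: "'g::{topological_group_add,t2_space} measure \<Rightarrow> bool" where
  "left_haar_measure \<mu> \<longleftrightarrow>
     sets \<mu> = sets borel \<and>
     emeasure \<mu> UNIV \<noteq> 0 \<and>
     (\<forall>K. compact K \<longrightarrow> emeasure \<mu> K < \<infinity>) \<and>
     (\<forall>A\<in>sets borel. emeasure \<mu> A = (INF U\<in>{U. open U \<and> A \<subseteq> U}. emeasure \<mu> U)) \<and>
     (\<forall>U. open U \<longrightarrow> emeasure \<mu> U = (SUP K\<in>{K. compact K \<and> K \<subseteq> U}. emeasure \<mu> K)) \<and>
     (\<forall>s. \<forall>A\<in>sets borel. emeasure \<mu> ((+) s ` A) = emeasure \<mu> A)"


subsection \<open>Operators on \<open>L\<^sup>2(G)\<close>\<close>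

text \<open>
  Elements of \<open>L\<^sup>2(G)\<close> are represented by square integrable functions, with equality read as equality
  almost everywhere. Accordingly an operator is a map on functions whose defining identities hold
  almost everywhere (linearity and boundedness make it respect equality almost everywhere), and two
  operators agree if their values agree almost everywhere on every square integrable function.
\<close>

definition L2_fun :: "'g measure \<Rightarrow> ('g \<Rightarrow> complex) set" where
  "L2_fun \<mu> = {\<xi>. \<xi> \<in> borel_measurable \<mu> \<and> integrable \<mu> (\<lambda>t. (cmod (\<xi> t))\<^sup>2)}"

definition L2_inner :: "'g measure \<Rightarrow> ('g \<Rightarrow> complex) \<Rightarrow> ('g \<Rightarrow> complex) \<Rightarrow> complex" where
  "L2_inner \<mu> \<xi> \<eta> = (\<integral>t. \<xi> t * cnj (\<eta> t) \<partial>\<mu>)"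

definition L2_norm :: "'g measure \<Rightarrow> ('g \<Rightarrow> complex) \<Rightarrow> real" where
  "L2_norm \<mu> \<xi> = sqrt (\<integral>t. (cmod (\<xi> t))\<^sup>2 \<partial>\<mu>)"

type_synonym 'g operator = "('g \<Rightarrow> complex) \<Rightarrow> ('g \<Rightarrow> complex)"

definition bounded_operators :: "'g measure \<Rightarrow> 'g operator set" where
  "bounded_operators \<mu> = {T.
     (\<forall>\<xi>\<in>L2_fun \<mu>. T \<xi> \<in> L2_fun \<mu>) \<and>
     (\<forall>\<xi>\<in>L2_fun \<mu>. \<forall>\<eta>\<in>L2_fun \<mu>. AE t in \<mu>. T (\<lambda>u. \<xi> u + \<eta> u) t = T \<xi> t + T \<eta> t) \<and>
     (\<forall>c. \<forall>\<xi>\<in>L2_fun \<mu>. AE t in \<mu>. T (\<lambda>u. c * \<xi> u) t = c * T \<xi> t) \<and>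
     (\<exists>C. \<forall>\<xi>\<in>L2_fun \<mu>. L2_norm \<mu> (T \<xi>) \<le> C * L2_norm \<mu> \<xi>)}"

definition commutant :: "'g measure \<Rightarrow> 'g operator set \<Rightarrow> 'g operator set" where
  "commutant \<mu> M = {T \<in> bounded_operators \<mu>.
     \<forall>S\<in>M. \<forall>\<xi>\<in>L2_fun \<mu>. AE t in \<mu>. T (S \<xi>) t = S (T \<xi>) t}"

text \<open>A bicommutant contains the identity, so unitality is implied.\<close>

definition von_neumann_algebra :: "'g measure \<Rightarrow> 'g operator set \<Rightarrow> bool" where
  "von_neumann_algebra \<mu> M \<longleftrightarrow>
     M \<subseteq> bounded_operators \<mu> \<and>
     (\<forall>S\<in>M. \<forall>T\<in>M. (\<lambda>\<xi> t. S \<xi> t + T \<xi> t) \<in> M) \<and>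
     (\<forall>c. \<forall>T\<in>M. (\<lambda>\<xi> t. c * T \<xi> t) \<in> M) \<and>
     (\<forall>S\<in>M. \<forall>T\<in>M. S \<circ> T \<in> M) \<and>
     (\<forall>T\<in>M. \<exists>S\<in>M. \<forall>\<xi>\<in>L2_fun \<mu>. \<forall>\<eta>\<in>L2_fun \<mu>. L2_inner \<mu> (T \<xi>) \<eta> = L2_inner \<mu> \<xi> (S \<eta>)) \<and>
     commutant \<mu> (commutant \<mu> M) = M"

definition left_regular :: "'g::group_add \<Rightarrow> 'g operator" where
  "left_regular s \<xi> = (\<lambda>t. \<xi> (- s + t))"

definition group_vN :: "'g::group_add measure \<Rightarrow> 'g operator set" where
  "group_vN \<mu> = \<Inter>{M. von_neumann_algebra \<mu> M \<and> range left_regular \<subseteq> M}"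


subsection \<open>The Fourier algebra as the predual of \<open>VN(G)\<close>\<close>

definition fourier_algebra :: "'g::group_add measure \<Rightarrow> ('g \<Rightarrow> complex) set" where
  "fourier_algebra \<mu> =
     {f. \<exists>\<xi>\<in>L2_fun \<mu>. \<exists>\<eta>\<in>L2_fun \<mu>. f = (\<lambda>s. L2_inner \<mu> (left_regular s \<xi>) \<eta>)}"

text \<open>
  The predual of \<open>VN(G)\<close> consists of the normal (ultraweakly continuous) functionals; only the values
  on \<open>VN(G)\<close> matter.
\<close>

definition normal_functional :: "'g::group_add measure \<Rightarrow> ('g operator \<Rightarrow> complex) \<Rightarrow> bool" where
  "normal_functional \<mu> \<phi> \<longleftrightarrow>
     (\<exists>\<xi> \<eta> :: nat \<Rightarrow> 'g \<Rightarrow> complex.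
        (\<forall>k. \<xi> k \<in> L2_fun \<mu> \<and> \<eta> k \<in> L2_fun \<mu>) \<and>
        summable (\<lambda>k. (L2_norm \<mu> (\<xi> k))\<^sup>2) \<and> summable (\<lambda>k. (L2_norm \<mu> (\<eta> k))\<^sup>2) \<and>
        (\<forall>T\<in>group_vN \<mu>. \<phi> T = (\<Sum>k. L2_inner \<mu> (T (\<xi> k)) (\<eta> k))))"

text \<open>
  The duality between \<open>A(G)\<close> and \<open>VN(G)\<close>, fixed by \<open>\<langle>f, \<lambda>(s)\<rangle> = f s\<close>. On \<open>VN(G)\<close> the functional is
  unique, since the linear span of the \<open>\<lambda>(s)\<close> is ultraweakly dense, and for \<open>f s = \<langle>\<lambda>(s)\<xi>, \<eta>\<rangle>\<close> it is
  \<open>T \<mapsto> \<langle>T\<xi>, \<eta>\<rangle>\<close>.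
\<close>

definition fourier_pairing ::
    "'g::group_add measure \<Rightarrow> ('g \<Rightarrow> complex) \<Rightarrow> 'g operator \<Rightarrow> complex" where
  "fourier_pairing \<mu> f = (SOME \<phi>. normal_functional \<mu> \<phi> \<and> (\<forall>s. \<phi> (left_regular s) = f s))"


subsection \<open>Matrix norms\<close>

text \<open>
  An operator space structure is given by its norms on \<open>n \<times> n\<close> matrices, indexed by \<open>i, j < n\<close>.
  Norms take values in \<^typ>\<open>ennreal\<close> so that suprema and infima need no side conditions.
  The first two definitions are operator norms: of a complex matrix indexed by a finite set, and of
  an \<open>m \<times> m\<close> matrix of operators acting on the \<open>m\<close>-fold Hilbert sum of \<open>L\<^sup>2(G)\<close>.
\<close>

definition complex_mat_norm :: "'i set \<Rightarrow> ('i \<Rightarrow> 'i \<Rightarrow> complex) \<Rightarrow> ennreal" where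
  "complex_mat_norm I a =
     (SUP v\<in>{v. L2_set (\<lambda>j. cmod (v j)) I \<le> 1}.
        ennreal (L2_set (\<lambda>i. cmod (\<Sum>j\<in>I. a i j * v j)) I))"

definition operator_mat_norm :: "'g measure \<Rightarrow> nat \<Rightarrow> (nat \<Rightarrow> nat \<Rightarrow> 'g operator) \<Rightarrow> ennreal" where
  "operator_mat_norm \<mu> m T =
     (SUP \<xi>\<in>{\<xi>. (\<forall>l<m. \<xi> l \<in> L2_fun \<mu>) \<and> L2_set (\<lambda>l. L2_norm \<mu> (\<xi> l)) {..<m} \<le> 1}.
        ennreal (L2_set (\<lambda>k. L2_norm \<mu> (\<lambda>t. \<Sum>l<m. T k l (\<xi> l) t)) {..<m}))"

text \<open>
  The predual structure on \<open>A(G)\<close>: the norm of \<open>[f\<^sub>i\<^sub>j]\<close> is the completely bounded norm of the map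
  \<open>T \<mapsto> [\<langle>f\<^sub>i\<^sub>j, T\<rangle>]\<close> from \<open>VN(G)\<close> to the \<open>n \<times> n\<close> matrices. For \<open>n = 1\<close> it is the predual norm.
\<close>

definition fourier_mat_norm ::
    "'g::group_add measure \<Rightarrow> nat \<Rightarrow> (nat \<Rightarrow> nat \<Rightarrow> 'g \<Rightarrow> complex) \<Rightarrow> ennreal" where
  "fourier_mat_norm \<mu> n f =
     (SUP (m, T)\<in>{(m, T). (\<forall>k<m. \<forall>l<m. T k l \<in> group_vN \<mu>) \<and> operator_mat_norm \<mu> m T \<le> 1}.
        complex_mat_norm ({..<n} \<times> {..<m})
          (\<lambda>(i, k) (j, l). fourier_pairing \<mu> (f i j) (T k l)))"

definition vanishing_ideal :: "'g::group_add measure \<Rightarrow> 'g set \<Rightarrow> ('g \<Rightarrow> complex) set" where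
  "vanishing_ideal \<mu> E = {f \<in> fourier_algebra \<mu>. \<forall>x\<in>E. f x = 0}"

definition fourier_quotient :: "'g::group_add measure \<Rightarrow> 'g set \<Rightarrow> ('g \<Rightarrow> complex) set set" where
  "fourier_quotient \<mu> E = fourier_algebra \<mu> //
     {(f, g) \<in> fourier_algebra \<mu> \<times> fourier_algebra \<mu>. (\<lambda>x. f x - g x) \<in> vanishing_ideal \<mu> E}"

definition fourier_quotient_mat_norm ::
    "'g::group_add measure \<Rightarrow> nat \<Rightarrow> (nat \<Rightarrow> nat \<Rightarrow> ('g \<Rightarrow> complex) set) \<Rightarrow> ennreal" where
  "fourier_quotient_mat_norm \<mu> n F =
     (INF f\<in>{f. \<forall>i<n. \<forall>j<n. f i j \<in> F i j}. fourier_mat_norm \<mu> n f)"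

text \<open>Functions on \<open>E\<close> are represented as functions that are \<^const>\<open>undefined\<close> outside \<open>E\<close>.\<close>

definition C0 :: "'g::topological_space set \<Rightarrow> ('g \<Rightarrow> complex) set" where
  "C0 E = {h \<in> extensional E. continuous_on E h \<and>
     (\<forall>e>0. \<exists>K. compact K \<and> K \<subseteq> E \<and> (\<forall>x\<in>E - K. cmod (h x) < e))}"

definition min_mat_norm :: "'g set \<Rightarrow> nat \<Rightarrow> (nat \<Rightarrow> nat \<Rightarrow> 'g \<Rightarrow> complex) \<Rightarrow> ennreal" where
  "min_mat_norm E n h = (SUP x\<in>E. complex_mat_norm {..<n} (\<lambda>i j. h i j x))"

text \<open>Applied to linear maps only, so linearity is not part of the definition.\<close>

definition completely_bounded ::
    "'a set \<Rightarrow> (nat \<Rightarrow> (nat \<Rightarrow> nat \<Rightarrow> 'a) \<Rightarrow> ennreal) \<Rightarrow>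
     (nat \<Rightarrow> (nat \<Rightarrow> nat \<Rightarrow> 'b) \<Rightarrow> ennreal) \<Rightarrow> ('a \<Rightarrow> 'b) \<Rightarrow> bool" where
  "completely_bounded X normX normY u \<longleftrightarrow>
     (\<exists>C::real. \<forall>n x. (\<forall>i<n. \<forall>j<n. x i j \<in> X) \<longrightarrow>
        normY n (\<lambda>i j. u (x i j)) \<le> ennreal C * normX n x)"


subsection \<open>cb-Helson sets\<close>

text \<open>All elements of a class in \<open>A(G)/I\<^sub>E\<close> have the same restriction to \<open>E\<close>.\<close>

definition fourier_restriction :: "'g set \<Rightarrow> ('g \<Rightarrow> complex) set \<Rightarrow> 'g \<Rightarrow> complex" where
  "fourier_restriction E F = the_elem ((\<lambda>f. restrict f E) ` F)"

definition cb_Helson_set :: "'g::{topological_group_add,t2_space} measure \<Rightarrow> 'g set \<Rightarrow> bool" where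
  "cb_Helson_set \<mu> E \<longleftrightarrow>
     closed E \<and>
     fourier_restriction E ` fourier_quotient \<mu> E = C0 E \<and>
     completely_bounded (C0 E) (min_mat_norm E) (fourier_quotient_mat_norm \<mu>)
       (inv_into (fourier_quotient \<mu> E) (fourier_restriction E))"

end

theory Submission
  imports Defs
begin

text \<open>
  If \<open>E\<close> is infinite, some coset \<open>y H\<close> contains distinct points \<open>x\<^sub>r = y h\<^sub>r\<close> (\<open>r < N\<close>) of \<open>E\<close>, for
  every \<open>N\<close>. Let \<open>a\<^sub>r\<close> be anticommuting real symmetric matrices with square \<open>1\<close>, and choose a subpartition of
  unity \<open>\<phi>\<^sub>r\<close> with \<open>\<phi>\<^sub>r(x\<^sub>s) = \<delta>\<^sub>r\<^sub>s\<close>. The matrix \<open>\<Sum>\<^sub>r \<phi>\<^sub>r a\<^sub>r\<close> over \<open>C\<^sub>0(E)\<close> has norm at most \<open>1\<close>.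
  On the other hand the operator \<open>\<Sum>\<^sub>r a\<^sub>r \<otimes> \<lambda>(x\<^sub>r)\<close> has norm at most \<open>\<surd>(2N)\<close>: up to the unitary
  \<open>\<lambda>(y)\<close> it is half the sum of \<open>\<Sum>\<^sub>r a\<^sub>r \<otimes> (U\<^sub>r + U\<^sub>r\<^sup>*)\<close> and \<open>\<Sum>\<^sub>r a\<^sub>r \<otimes> (U\<^sub>r - U\<^sub>r\<^sup>*)\<close> with commuting
  unitaries \<open>U\<^sub>r = \<lambda>(h\<^sub>r)\<close>, and the off-diagonal terms of the square of either sum cancel by
  anticommutation. Pairing it with any lift of \<open>\<Sum>\<^sub>r \<phi>\<^sub>r a\<^sub>r\<close> gives \<open>\<Sum>\<^sub>r a\<^sub>r \<otimes> a\<^sub>r\<close>, which has norm \<open>N\<close>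
  (attained at the maximally entangled vector). So the complete bound is at least \<open>N / \<surd>(2N) = \<surd>(N/2)\<close> for every \<open>N\<close>.
\<close>

subsection \<open>Clifford matrices\<close>

lemma sum_lessThan_double:
  fixes f :: "nat \<Rightarrow> 'a::comm_monoid_add"
  shows "sum f {..<2 * n} = (\<Sum>i<n. f (2 * i) + f (2 * i + 1))"
  by (induction n) (simp_all add: ac_simps)

text \<open>Generators of a Clifford algebra as real symmetric matrices: the single anticommutator
  identity contains both \<open>a r\<close> squared equal to 1 (for r = s) and anticommutation (for
  r \<noteq> s). Asking symmetry at all indices spares range conditions when entries are
  transposed.\<close>

definition clifford_matrices :: "nat \<Rightarrow> nat \<Rightarrow> (nat \<Rightarrow> nat \<Rightarrow> nat \<Rightarrow> real) \<Rightarrow> bool" where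
  "clifford_matrices N n a \<longleftrightarrow>
     (\<forall>r<N. \<forall>i j. a r i j = a r j i) \<and>
     (\<forall>r<N. \<forall>s<N. \<forall>i<n. \<forall>k<n.
        (\<Sum>j<n. a r i j * a s j k + a s i j * a r j k) = (if r = s \<and> i = k then 2 else 0))"

text \<open>Each new generator doubles the size: an old matrix \<open>a r\<close> becomes its tensor
  product with diag(1,-1), and the new generator is the identity tensored with the flip of two
  coordinates.\<close>

lemma clifford_matrices_exist: "\<exists>a. clifford_matrices N (2 ^ N) a"
  unfolding clifford_matrices_def
proof (induction N)
  case 0
  then show ?case by simp
next
  case (Suc N)
  then obtain a :: "nat \<Rightarrow> nat \<Rightarrow> nat \<Rightarrow> real" where
    sym': "\<forall>r<N. \<forall>i j. a r i j = a r j i"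
    and anti': "\<forall>r<N. \<forall>s<N. \<forall>i<2 ^ N. \<forall>k<2 ^ N.
        (\<Sum>j<2 ^ N. a r i j * a s j k + a s i j * a r j k) = (if r = s \<and> i = k then 2 else 0)"
    by (elim exE conjE)
  have sym: "a r i j = a r j i" if "r < N" for r i j
    using sym' that by blast
  have anti: "(\<Sum>j<2 ^ N. a r i j * a s j k + a s i j * a r j k) = (if r = s \<and> i = k then 2 else 0)"
    if "r < N" "s < N" "i < 2 ^ N" "k < 2 ^ N" for r s i k
    using anti' that by blast
  let ?n = "2 ^ N :: nat"
  \<comment> \<open>An index i encodes the pair (i div 2, i mod 2): the quotient is the old index,
    the parity is the coordinate in the new two-dimensional factor.\<close>
  define b :: "nat \<Rightarrow> nat \<Rightarrow> nat \<Rightarrow> real" where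
    "b r i j = (if r < N
       then (if even i = even j then (if even i then 1 else -1) * a r (i div 2) (j div 2) else 0)
       else if i div 2 = j div 2 \<and> even i \<noteq> even j then 1 else 0)" for r i j
  have symb: "b r i j = b r j i" for r i j
    unfolding b_def using sym[of r "i div 2" "j div 2"] by auto
  \<comment> \<open>The anticommutator is symmetric in r and s, so it suffices to treat r \<le> s;
    this leaves two old generators, an old one with the new one, or the new one squared.\<close>
  have *: "(\<Sum>j<2 ^ Suc N. b r i j * b s j k + b s i j * b r j k) = (if r = s \<and> i = k then 2 else 0)"
    if "r \<le> s" "s < Suc N" "i < 2 ^ Suc N" "k < 2 ^ Suc N" for r s i k
  proof -
    let ?i = "i div 2" and ?k = "k div 2"
    have lt: "?i < ?n" "?k < ?n" using that by auto
    have ik: "i = k \<longleftrightarrow> ?i = ?k \<and> even i = even k"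
      by (metis dvd_mult_div_cancel odd_two_times_div_two_succ)
    define L where "L = (\<Sum>j<2 ^ Suc N. b r i j * b s j k + b s i j * b r j k)"
    have S: "L =
        (\<Sum>j<?n. (b r i (2 * j) * b s (2 * j) k + b s i (2 * j) * b r (2 * j) k) +
          (b r i (2 * j + 1) * b s (2 * j + 1) k + b s i (2 * j + 1) * b r (2 * j + 1) k))"
      using sum_lessThan_double[of "\<lambda>j. b r i j * b s j k + b s i j * b r j k" ?n]
      by (simp add: L_def)
    consider "s < N" | "r < N" "s = N" | "r = N" "s = N" using \<open>r \<le> s\<close> \<open>s < Suc N\<close> by linarith
    then have "L = (if r = s \<and> i = k then 2 else 0)"
    proof cases
      case 1
      then have "r < N" using \<open>r \<le> s\<close> by simp
      show ?thesis
      proof (cases "even i = even k")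
        case True
        have "L =
            (\<Sum>j<?n. a r ?i j * a s j ?k + a s ?i j * a r j ?k)"
          unfolding S by (rule sum.cong) (use 1 \<open>r < N\<close> True in \<open>auto simp: b_def\<close>)
        then show ?thesis using anti[OF \<open>r < N\<close> 1 lt] ik True by simp
      next
        case False
        then have "L = 0"
          unfolding S by (intro sum.neutral) (use 1 \<open>r < N\<close> in \<open>auto simp: b_def\<close>)
        then show ?thesis using ik False by simp
      qed
    next
      case 2
      show ?thesis
      proof (cases "even i = even k")
        case True
        then have "L = 0"
          unfolding S by (intro sum.neutral) (use 2 in \<open>auto simp: b_def\<close>)
        then show ?thesis using 2 by simp
      next
        case False
        \<comment> \<open>The surviving middle index has the parity of i in the first product and
          that of k in the second. These parities differ, so the signs are opposite: diag(1,-1)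
          anticommutes with the flip.\<close>
        have "L =
            (\<Sum>j<?n. (if j = ?k then (if even i then 1 else -1) * a r ?i ?k else 0)
               + (if j = ?i then (if even k then 1 else -1) * a r ?i ?k else 0))"
          unfolding S by (rule sum.cong) (use 2 False in \<open>auto simp: b_def elim!: oddE\<close>)
        also have "\<dots> = 0"
          using lt False by (auto simp: sum.distrib)
        finally show ?thesis using 2 by simp
      qed
    next
      case 3
      have "L =
            (\<Sum>j<?n. if j = ?i then (if i = k then 2 else 0) else 0)"
        unfolding S ik by (rule sum.cong) (use 3 in \<open>auto simp: b_def\<close>)
      then show ?thesis using 3 lt by simp
    qed
    then show ?thesis by (simp only: L_def)
  qed
  have "(\<Sum>j<2 ^ Suc N. b r i j * b s j k + b s i j * b r j k) = (if r = s \<and> i = k then 2 else 0)"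
    if "r < Suc N" "s < Suc N" "i < 2 ^ Suc N" "k < 2 ^ Suc N" for r s i k
    using *[of r s i k, OF _ that(2-4)] *[of s r i k, OF _ that(1,3,4)]
    by (cases "r \<le> s") (simp_all only: add.commute eq_commute[of s r] nle_le)
  with symb show ?case by blast
qed

subsection \<open>Translations on \<open>L\<^sup>2(G)\<close>\<close>

lemma haar_sets: "left_haar_measure \<mu> \<Longrightarrow> sets \<mu> = sets borel"
  by (simp add: left_haar_measure_def)

lemma haar_translate_measurable:
  assumes "left_haar_measure \<mu>"
  shows "(+) s \<in> measurable \<mu> \<mu>"
proof -
  have "continuous_on UNIV ((+) s)"
    by (intro continuous_intros)
  then have "(+) s \<in> borel_measurable borel"
    by (rule borel_measurable_continuous_onI)
  then show ?thesis
    using measurable_cong_sets[OF haar_sets haar_sets, OF assms assms] by blast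
qed

text \<open>Invariance is stated for images while \<open>distr\<close> uses preimages; the preimage
  of A under translation by s is the image of A under translation by -s.\<close>

lemma haar_distr:
  assumes "left_haar_measure \<mu>"
  shows "distr \<mu> \<mu> ((+) s) = \<mu>"
proof (rule measure_eqI)
  fix A assume "A \<in> sets (distr \<mu> \<mu> ((+) s))"
  then have A: "A \<in> sets borel" "A \<in> sets \<mu>" using haar_sets[OF assms] by auto
  have "((+) s -` A \<inter> space \<mu>) = (+) (- s) ` A"
  proof -
    have "space \<mu> = UNIV" using sets_eq_imp_space_eq[OF haar_sets[OF assms]] by simp
    then show ?thesis
      by (force simp: image_iff add.assoc[symmetric] intro: bexI[of _ "s + _"])
  qed
  then have "emeasure (distr \<mu> \<mu> ((+) s)) A = emeasure \<mu> ((+) (- s) ` A)"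
    using haar_translate_measurable[OF assms] A by (simp add: emeasure_distr)
  also have "\<dots> = emeasure \<mu> A" using assms A by (simp add: left_haar_measure_def)
  finally show "emeasure (distr \<mu> \<mu> ((+) s)) A = emeasure \<mu> A" .
qed simp

lemma haar_integral_translate:
  fixes f :: "'g::{topological_group_add,t2_space} \<Rightarrow> 'b::{banach, second_countable_topology}"
  assumes "left_haar_measure \<mu>" "f \<in> borel_measurable \<mu>"
  shows "(\<integral>t. f (s + t) \<partial>\<mu>) = (\<integral>t. f t \<partial>\<mu>)"
  using integral_distr[OF haar_translate_measurable[OF assms(1)] assms(2)]
  by (simp add: haar_distr[OF assms(1)])

lemma haar_integrable_translate:
  fixes f :: "'g::{topological_group_add,t2_space} \<Rightarrow> 'b::{banach, second_countable_topology}"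
  assumes "left_haar_measure \<mu>" "integrable \<mu> f"
  shows "integrable \<mu> (\<lambda>t. f (s + t))"
  using integrable_distr[OF haar_translate_measurable[OF assms(1)]] assms(2)
  by (simp add: haar_distr[OF assms(1)])

section \<open>Square integrable functions and their inner product\<close>

lemma L2_norm_squared: "(L2_norm \<mu> f)\<^sup>2 = (\<integral>t. (cmod (f t))\<^sup>2 \<partial>\<mu>)"
  by (simp add: L2_norm_def)

lemma of_real_L2_norm_squared:
  "complex_of_real ((L2_norm \<mu> f)\<^sup>2) = L2_inner \<mu> f f"
  unfolding L2_norm_squared L2_inner_def complex_norm_square[symmetric]
  by (simp flip: of_real_power)

lemma L2_fun_add:
  assumes "f \<in> L2_fun \<mu>" "g \<in> L2_fun \<mu>"
  shows "(\<lambda>t. f t + g t) \<in> L2_fun \<mu>"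
proof -
  have [measurable]: "f \<in> borel_measurable \<mu>" "g \<in> borel_measurable \<mu>"
    using assms by (auto simp: L2_fun_def)
  have "integrable \<mu> (\<lambda>t. (cmod (f t + g t))\<^sup>2)"
  proof (rule Bochner_Integration.integrable_bound)
    show "integrable \<mu> (\<lambda>t. 2 * (cmod (f t))\<^sup>2 + 2 * (cmod (g t))\<^sup>2)"
      using assms by (auto simp: L2_fun_def)
    have "(cmod (f t + g t))\<^sup>2 \<le> 2 * (cmod (f t))\<^sup>2 + 2 * (cmod (g t))\<^sup>2" for t
    proof -
      have "(cmod (f t + g t))\<^sup>2 \<le> (cmod (f t) + cmod (g t))\<^sup>2"
        by (intro power_mono norm_triangle_ineq) simp
      also have "\<dots> \<le> 2 * (cmod (f t))\<^sup>2 + 2 * (cmod (g t))\<^sup>2"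
        using sum_squares_bound[of "cmod (f t)" "cmod (g t)"] by (simp add: power2_sum)
      finally show ?thesis .
    qed
    then show "AE t in \<mu>. norm ((cmod (f t + g t))\<^sup>2) \<le> norm (2 * (cmod (f t))\<^sup>2 + 2 * (cmod (g t))\<^sup>2)"
      by simp
  qed measurable
  then show ?thesis by (simp add: L2_fun_def)
qed

lemma L2_fun_scale: "f \<in> L2_fun \<mu> \<Longrightarrow> (\<lambda>t. c * f t) \<in> L2_fun \<mu>"
  by (auto simp: L2_fun_def norm_mult power_mult_distrib)

lemma L2_fun_zero: "(\<lambda>t. 0) \<in> L2_fun \<mu>"
  by (simp add: L2_fun_def)

lemma L2_fun_sum: "(\<And>i. i \<in> I \<Longrightarrow> f i \<in> L2_fun \<mu>) \<Longrightarrow> (\<lambda>t. \<Sum>i\<in>I. f i t) \<in> L2_fun \<mu>"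
  by (induction I rule: infinite_finite_induct) (simp_all add: L2_fun_zero L2_fun_add)

lemma L2_fun_diff: "f \<in> L2_fun \<mu> \<Longrightarrow> g \<in> L2_fun \<mu> \<Longrightarrow> (\<lambda>t. f t - g t) \<in> L2_fun \<mu>"
  using L2_fun_add[of f \<mu> "\<lambda>t. - 1 * g t"] L2_fun_scale[of g \<mu> "- 1"] by simp

lemma L2_inner_integrable:
  assumes "f \<in> L2_fun \<mu>" "g \<in> L2_fun \<mu>"
  shows "integrable \<mu> (\<lambda>t. f t * cnj (g t))"
proof (rule Bochner_Integration.integrable_bound)
  have [measurable]: "f \<in> borel_measurable \<mu>" "g \<in> borel_measurable \<mu>"
    using assms by (auto simp: L2_fun_def)
  show "integrable \<mu> (\<lambda>t. (cmod (f t))\<^sup>2 + (cmod (g t))\<^sup>2)"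
    using assms by (auto simp: L2_fun_def)
  have "cmod (f t) * cmod (g t) \<le> (cmod (f t))\<^sup>2 + (cmod (g t))\<^sup>2" for t
    using sum_squares_bound[of "cmod (f t)" "cmod (g t)"]
      mult_nonneg_nonneg[OF norm_ge_zero norm_ge_zero, of "f t" "g t"] by linarith
  then show "AE t in \<mu>. norm (f t * cnj (g t)) \<le> norm ((cmod (f t))\<^sup>2 + (cmod (g t))\<^sup>2)"
    by (simp add: norm_mult)
  have "g \<in> borel_measurable \<mu>" by measurable
  then have "(\<lambda>t. cnj (g t)) \<in> borel_measurable \<mu>"
    by (rule measurable_compose) (intro borel_measurable_continuous_onI continuous_intros)
  then show "(\<lambda>t. f t * cnj (g t)) \<in> borel_measurable \<mu>" by measurable
qed

lemma L2_inner_scale_left: "L2_inner \<mu> (\<lambda>t. c * f t) g = c * L2_inner \<mu> f g"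
  by (simp add: L2_inner_def mult.assoc)

lemma L2_inner_scale_right: "L2_inner \<mu> f (\<lambda>t. c * g t) = cnj c * L2_inner \<mu> f g"
  by (simp add: L2_inner_def mult.left_commute)

lemma L2_inner_sum_left:
  assumes "\<And>i. i \<in> I \<Longrightarrow> f i \<in> L2_fun \<mu>" "g \<in> L2_fun \<mu>"
  shows "L2_inner \<mu> (\<lambda>t. \<Sum>i\<in>I. f i t) g = (\<Sum>i\<in>I. L2_inner \<mu> (f i) g)"
  unfolding L2_inner_def sum_distrib_right
  by (rule Bochner_Integration.integral_sum) (use assms L2_inner_integrable in blast)

lemma L2_inner_sum_right:
  assumes "\<And>i. i \<in> I \<Longrightarrow> g i \<in> L2_fun \<mu>" "f \<in> L2_fun \<mu>"
  shows "L2_inner \<mu> f (\<lambda>t. \<Sum>i\<in>I. g i t) = (\<Sum>i\<in>I. L2_inner \<mu> f (g i))"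
  unfolding L2_inner_def sum_distrib_left cnj_sum
  by (rule Bochner_Integration.integral_sum) (use assms L2_inner_integrable in blast)

lemma L2_inner_add:
  assumes "f \<in> L2_fun \<mu>" "f' \<in> L2_fun \<mu>" "g \<in> L2_fun \<mu>"
  shows "L2_inner \<mu> (\<lambda>t. f t + f' t) g = L2_inner \<mu> f g + L2_inner \<mu> f' g"
    and "L2_inner \<mu> g (\<lambda>t. f t + f' t) = L2_inner \<mu> g f + L2_inner \<mu> g f'"
  using L2_inner_integrable[OF assms(1) assms(3)] L2_inner_integrable[OF assms(2) assms(3)]
    L2_inner_integrable[OF assms(3) assms(1)] L2_inner_integrable[OF assms(3) assms(2)]
  by (simp_all add: L2_inner_def distrib_left distrib_right left_diff_distrib right_diff_distrib)

lemma L2_inner_diff: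
  assumes "f \<in> L2_fun \<mu>" "f' \<in> L2_fun \<mu>" "g \<in> L2_fun \<mu>"
  shows "L2_inner \<mu> (\<lambda>t. f t - f' t) g = L2_inner \<mu> f g - L2_inner \<mu> f' g"
    and "L2_inner \<mu> g (\<lambda>t. f t - f' t) = L2_inner \<mu> g f - L2_inner \<mu> g f'"
  using L2_inner_integrable[OF assms(1) assms(3)] L2_inner_integrable[OF assms(2) assms(3)]
    L2_inner_integrable[OF assms(3) assms(1)] L2_inner_integrable[OF assms(3) assms(2)]
  by (simp_all add: L2_inner_def distrib_left distrib_right left_diff_distrib right_diff_distrib)

section \<open>Left translations as unitaries\<close>

lemma L2_fun_left_regular:
  assumes "left_haar_measure \<mu>" "f \<in> L2_fun \<mu>"
  shows "left_regular s f \<in> L2_fun \<mu>"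
proof -
  have "(\<lambda>t. f (- s + t)) \<in> borel_measurable \<mu>"
    using assms(2) haar_translate_measurable[OF assms(1)]
    by (intro measurable_compose[of "(+) (- s)" \<mu> \<mu> f]) (auto simp: L2_fun_def)
  moreover have "integrable \<mu> (\<lambda>t. (cmod (f (- s + t)))\<^sup>2)"
    using haar_integrable_translate[OF assms(1), of "\<lambda>t. (cmod (f t))\<^sup>2"] assms(2)
    by (simp add: L2_fun_def)
  ultimately show ?thesis by (simp add: L2_fun_def left_regular_def)
qed

lemma L2_norm_left_regular:
  assumes "left_haar_measure \<mu>" "f \<in> L2_fun \<mu>"
  shows "L2_norm \<mu> (left_regular s f) = L2_norm \<mu> f"
  using haar_integral_translate[OF assms(1), of "\<lambda>t. (cmod (f t))\<^sup>2" "- s"] assms(2)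
  by (auto simp: L2_norm_def left_regular_def L2_fun_def dest: borel_measurable_integrable)

lemma left_regular_add: "left_regular (s + t) f = left_regular s (left_regular t f)"
  by (simp add: left_regular_def minus_add add.assoc del: add_uminus_conv_diff)

text \<open>Writing u = v + (-v + u), a common translation by v appears in both arguments and is
  removed by invariance; in effect the adjoint of a translation is the inverse translation.\<close>

lemma L2_inner_left_regular:
  assumes "left_haar_measure \<mu>" "f \<in> L2_fun \<mu>" "g \<in> L2_fun \<mu>"
  shows "L2_inner \<mu> (left_regular u f) (left_regular v g) = L2_inner \<mu> (left_regular (- v + u) f) g"
proof -
  have "left_regular u f = left_regular v (left_regular (- v + u) f)"
    by (simp flip: left_regular_add add: add.assoc[symmetric])
  then show ?thesis
    using haar_integral_translate[OF assms(1), of "\<lambda>t. left_regular (- v + u) f t * cnj (g t)" "- v"]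
      borel_measurable_integrable[OF L2_inner_integrable[OF L2_fun_left_regular[OF assms(1,2)] assms(3)]]
    by (simp add: L2_inner_def) (simp add: left_regular_def)
qed

subsection \<open>Clifford combinations of commuting translations\<close>

lemma clifford_matrices_sym: "clifford_matrices N n a \<Longrightarrow> r < N \<Longrightarrow> a r i j = a r j i"
  by (simp add: clifford_matrices_def)

lemma clifford_matrices_anticommute:
  assumes "clifford_matrices N n a" "r < N" "s < N" "i < n" "k < n"
  shows "(\<Sum>j<n. a r i j * a s j k + a s i j * a r j k) = (if r = s \<and> i = k then 2 else 0)"
  using assms unfolding clifford_matrices_def by blast

lemma clifford_matrices_square:
  assumes "clifford_matrices N n a" "r < N" "i < n" "k < n"
  shows "(\<Sum>j<n. a r i j * a r j k) = (if i = k then 1 else 0)"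
proof -
  have "(\<Sum>j<n. a r i j * a r j k) + (\<Sum>j<n. a r i j * a r j k) = (if i = k then 2 else 0)"
    using clifford_matrices_anticommute[OF assms(1,2) assms(2-)] by (simp only: sum.distrib simp_thms)
  moreover have "x + x = (if c then 2 else 0) \<Longrightarrow> x = (if c then 1 else 0)" for x :: real and c
    by (cases c) auto
  ultimately show ?thesis by blast
qed

text \<open>In the expanded square, the coefficient of the inner product of \<open>z r l\<close> and
  \<open>z s l'\<close> is an entry of the product of \<open>a r\<close> and \<open>a s\<close>. The
  hypothesis \<open>symm\<close> allows averaging over the exchange of r and s, which replaces this
  product by half the anticommutator, so only the diagonal terms survive. The hypothesis models z r
  l = X_r \<xi>_l with commuting X_r that are all self-adjoint or all skew-adjoint.\<close>

lemma clifford_combination_norm: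
  assumes a: "clifford_matrices N n a"
    and L2: "\<And>r l. r < N \<Longrightarrow> l < n \<Longrightarrow> z r l \<in> L2_fun \<mu>"
    and symm: "\<And>r s l l'. r < N \<Longrightarrow> s < N \<Longrightarrow> l < n \<Longrightarrow> l' < n \<Longrightarrow>
      L2_inner \<mu> (z r l) (z s l') = L2_inner \<mu> (z s l) (z r l')"
  shows "(\<Sum>k<n. (L2_norm \<mu> (\<lambda>t. \<Sum>l<n. \<Sum>r<N. complex_of_real (a r k l) * z r l t))\<^sup>2) =
    (\<Sum>r<N. \<Sum>l<n. (L2_norm \<mu> (z r l))\<^sup>2)"
proof -
  define G where "G r l s l' = L2_inner \<mu> (z r l) (z s l')" for r l s l'
  define B where "B r s l l' = (\<Sum>k<n. complex_of_real (a r l k * a s k l'))" for r s l l'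
  define S where "S = (\<Sum>k<n. (L2_norm \<mu> (\<lambda>t. \<Sum>l<n. \<Sum>r<N. complex_of_real (a r k l) * z r l t))\<^sup>2)"
  have B: "B r s l l' + B s r l l' = (if r = s \<and> l = l' then 2 else 0)"
    if "r < N" "s < N" "l < n" "l' < n" for r s l l'
  proof -
    have "B r s l l' + B s r l l' = of_real (\<Sum>k<n. a r l k * a s k l' + a s l k * a r k l')"
      by (simp add: B_def sum.distrib)
    also have "(\<Sum>k<n. a r l k * a s k l' + a s l k * a r k l') = (if r = s \<and> l = l' then 2 else 0)"
      using clifford_matrices_anticommute[OF a that] .
    finally show ?thesis by simp
  qed
  have row: "(\<lambda>t. \<Sum>r<N. complex_of_real (a r k l) * z r l t) \<in> L2_fun \<mu>" if "l < n" for k l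
    by (intro L2_fun_sum L2_fun_scale L2) (use that in auto)
  have "complex_of_real S = (\<Sum>k<n. \<Sum>l<n. \<Sum>r<N. \<Sum>l'<n. \<Sum>s<N. a r k l * (a s k l' * G r l s l'))"
    unfolding S_def of_real_sum of_real_L2_norm_squared
  proof (rule sum.cong[OF refl])
    fix k assume "k \<in> {..<n}"
    let ?F = "\<lambda>t. \<Sum>l<n. \<Sum>r<N. complex_of_real (a r k l) * z r l t"
    have F: "?F \<in> L2_fun \<mu>" by (intro L2_fun_sum row) auto
    have "L2_inner \<mu> ?F ?F = (\<Sum>l<n. L2_inner \<mu> (\<lambda>t. \<Sum>r<N. complex_of_real (a r k l) * z r l t) ?F)"
      by (rule L2_inner_sum_left) (use row F in auto)
    also have "\<dots> = (\<Sum>l<n. \<Sum>r<N. L2_inner \<mu> (\<lambda>t. complex_of_real (a r k l) * z r l t) ?F)"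
      by (intro sum.cong refl L2_inner_sum_left L2_fun_scale L2 F) auto
    also have "\<dots> = (\<Sum>l<n. \<Sum>r<N. a r k l * L2_inner \<mu> (z r l) ?F)"
      by (simp only: L2_inner_scale_left)
    also have "\<dots> = (\<Sum>l<n. \<Sum>r<N. a r k l * (\<Sum>l'<n. \<Sum>s<N. a s k l' * G r l s l'))"
    proof (intro sum.cong refl arg_cong2[where f = "(*)"])
      fix l r assume lr: "l \<in> {..<n}" "r \<in> {..<N}"
      have z: "z r l \<in> L2_fun \<mu>" using lr by (intro L2) auto
      have "L2_inner \<mu> (z r l) ?F =
          (\<Sum>l'<n. L2_inner \<mu> (z r l) (\<lambda>t. \<Sum>s<N. complex_of_real (a s k l') * z s l' t))"
        by (rule L2_inner_sum_right) (use row z in auto)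
      also have "\<dots> = (\<Sum>l'<n. \<Sum>s<N. L2_inner \<mu> (z r l) (\<lambda>t. complex_of_real (a s k l') * z s l' t))"
        by (intro sum.cong refl L2_inner_sum_right L2_fun_scale L2 z) auto
      finally show "L2_inner \<mu> (z r l) ?F = (\<Sum>l'<n. \<Sum>s<N. a s k l' * G r l s l')"
        by (simp only: L2_inner_scale_right complex_cnj_complex_of_real G_def)
    qed
    finally show "L2_inner \<mu> ?F ?F = (\<Sum>l<n. \<Sum>r<N. \<Sum>l'<n. \<Sum>s<N. a r k l * (a s k l' * G r l s l'))"
      by (simp add: sum_distrib_left)
  qed
  also have "\<dots> = (\<Sum>l<n. \<Sum>r<N. \<Sum>l'<n. \<Sum>s<N. B r s l l' * G r l s l')"
  proof -
    have "(\<Sum>k<n. \<Sum>l<n. \<Sum>r<N. \<Sum>l'<n. \<Sum>s<N. a r k l * (a s k l' * G r l s l')) =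
        (\<Sum>l<n. \<Sum>r<N. \<Sum>l'<n. \<Sum>s<N. \<Sum>k<n. a r k l * (a s k l' * G r l s l'))"
      by (subst sum.swap, rule sum.cong[OF refl], subst sum.swap, rule sum.cong[OF refl],
          subst sum.swap, rule sum.cong[OF refl], subst sum.swap, rule sum.cong[OF refl]) simp
    also have "\<dots> = (\<Sum>l<n. \<Sum>r<N. \<Sum>l'<n. \<Sum>s<N. B r s l l' * G r l s l')"
    proof (intro sum.cong refl)
      fix l r l' s assume "r \<in> {..<N}"
      then have "a r k l = a r l k" for k using clifford_matrices_sym[OF a] by simp
      then show "(\<Sum>k<n. a r k l * (a s k l' * G r l s l')) = B r s l l' * G r l s l'"
        by (simp add: B_def sum_distrib_right mult.assoc)
    qed
    finally show ?thesis .
  qed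
  finally have S: "complex_of_real S = (\<Sum>l<n. \<Sum>r<N. \<Sum>l'<n. \<Sum>s<N. B r s l l' * G r l s l')" .
  also have "\<dots> = (\<Sum>l<n. \<Sum>l'<n. \<Sum>r<N. \<Sum>s<N. B r s l l' * G r l s l')"
    by (intro sum.cong refl sum.swap)
  also have "\<dots> = (\<Sum>l<n. \<Sum>l'<n. \<Sum>s<N. \<Sum>r<N. B r s l l' * G r l s l')"
    by (intro sum.cong refl sum.swap)
  also have "\<dots> = (\<Sum>l<n. \<Sum>s<N. \<Sum>l'<n. \<Sum>r<N. B r s l l' * G r l s l')"
    by (intro sum.cong refl sum.swap)
  \<comment> \<open>After \<open>symm\<close> and a renaming of bound indices, this is the
    expression in \<open>S\<close> with the coefficient \<open>B s r\<close> instead of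
    \<open>B r s\<close>. Adding the two produces the anticommutator.\<close>
  also have "\<dots> = (\<Sum>l<n. \<Sum>s<N. \<Sum>l'<n. \<Sum>r<N. B r s l l' * G s l r l')"
    unfolding G_def by (intro sum.cong refl arg_cong2[where f = "(*)"] symm) auto
  finally have "2 * complex_of_real S =
      (\<Sum>l<n. \<Sum>r<N. \<Sum>l'<n. \<Sum>s<N. (B r s l l' + B s r l l') * G r l s l')"
    using S by (simp add: sum.distrib distrib_right)
  also have "\<dots> = (\<Sum>l<n. \<Sum>r<N. \<Sum>l'<n. \<Sum>s<N. if r = s then if l = l' then 2 * G r l r l else 0 else 0)"
    by (intro sum.cong refl) (use B in auto)
  also have "\<dots> = (\<Sum>l<n. \<Sum>r<N. 2 * G r l r l)"
    by simp
  also have "\<dots> = (\<Sum>r<N. \<Sum>l<n. 2 * G r l r l)"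
    by (rule sum.swap)
  also have "\<dots> = 2 * complex_of_real (\<Sum>r<N. \<Sum>l<n. (L2_norm \<mu> (z r l))\<^sup>2)"
    by (simp add: G_def of_real_L2_norm_squared sum_distrib_left flip: of_real_power)
  finally have "S = (\<Sum>r<N. \<Sum>l<n. (L2_norm \<mu> (z r l))\<^sup>2)"
    by (simp only: mult_cancel_left of_real_eq_iff) simp
  then show ?thesis by (simp only: S_def)
qed

lemma L2_parallelogram:
  assumes "f \<in> L2_fun \<mu>" "g \<in> L2_fun \<mu>"
  shows "(L2_norm \<mu> (\<lambda>t. f t + g t))\<^sup>2 + (L2_norm \<mu> (\<lambda>t. f t - g t))\<^sup>2 =
    2 * (L2_norm \<mu> f)\<^sup>2 + 2 * (L2_norm \<mu> g)\<^sup>2"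
proof -
  have "complex_of_real ((L2_norm \<mu> (\<lambda>t. f t + g t))\<^sup>2 + (L2_norm \<mu> (\<lambda>t. f t - g t))\<^sup>2) =
      of_real (2 * (L2_norm \<mu> f)\<^sup>2 + 2 * (L2_norm \<mu> g)\<^sup>2)"
    unfolding of_real_add of_real_mult of_real_L2_norm_squared
    using assms by (simp add: L2_inner_add L2_inner_diff L2_fun_add L2_fun_diff)
  then show ?thesis by (simp only: of_real_eq_iff)
qed

lemma L2_norm_add_squared_le:
  assumes "f \<in> L2_fun \<mu>" "g \<in> L2_fun \<mu>"
  shows "(L2_norm \<mu> (\<lambda>t. f t + g t))\<^sup>2 \<le> 2 * (L2_norm \<mu> f)\<^sup>2 + 2 * (L2_norm \<mu> g)\<^sup>2"
  using L2_parallelogram[OF assms] zero_le_power2[of "L2_norm \<mu> (\<lambda>t. f t - g t)"] by linarith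

lemma L2_norm_scale: "L2_norm \<mu> (\<lambda>t. c * f t) = cmod c * L2_norm \<mu> f"
  by (simp add: L2_norm_def norm_mult power_mult_distrib real_sqrt_mult)

text \<open>The translation by y preserves norms, and twice the translation by \<open>h r\<close> is
  P + Q, its self-adjoint plus its skew-adjoint part (both doubled). Each part satisfies the
  preceding norm identity, and the parallelogram law, used twice, recombines them at the cost of the
  factor 2.\<close>

lemma clifford_translation_norm:
  assumes \<mu>: "left_haar_measure \<mu>" and a: "clifford_matrices N n a"
    and comm: "\<And>r s. r < N \<Longrightarrow> s < N \<Longrightarrow> h r + h s = h s + h r"
    and L2: "\<And>l. l < n \<Longrightarrow> \<xi> l \<in> L2_fun \<mu>"
  shows "(\<Sum>k<n. (L2_norm \<mu> (\<lambda>t. \<Sum>l<n. \<Sum>r<N. complex_of_real (a r k l) * left_regular (y + h r) (\<xi> l) t))\<^sup>2)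
    \<le> 2 * N * (\<Sum>l<n. (L2_norm \<mu> (\<xi> l))\<^sup>2)"
proof -
  define P where "P r l = (\<lambda>t. left_regular (h r) (\<xi> l) t + left_regular (- h r) (\<xi> l) t)" for r l
  define Q where "Q r l = (\<lambda>t. left_regular (h r) (\<xi> l) t - left_regular (- h r) (\<xi> l) t)" for r l
  define T where "T w k = (\<lambda>t. \<Sum>l<n. \<Sum>r<N. complex_of_real (a r k l) * w r l t)"
    for w :: "nat \<Rightarrow> nat \<Rightarrow> 'a \<Rightarrow> complex" and k
  have U: "left_regular s (\<xi> l) \<in> L2_fun \<mu>" if "l < n" for s l
    using L2_fun_left_regular[OF \<mu> L2[OF that]] .
  have PL2: "P r l \<in> L2_fun \<mu>" and QL2: "Q r l \<in> L2_fun \<mu>" if "l < n" for r l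
    unfolding P_def Q_def using U that by (intro L2_fun_add L2_fun_diff; simp)+
  have TL2: "T w k \<in> L2_fun \<mu>" if "\<And>r l. l < n \<Longrightarrow> w r l \<in> L2_fun \<mu>" for w k
    unfolding T_def by (intro L2_fun_sum L2_fun_scale that) auto
  \<comment> \<open>The adjoints are translations by inverses, so commutation is also needed between
    elements and inverses.\<close>
  have comms: "h r + h s = h s + h r" "- h s + h r = h r + - h s" "- h r + h s = h s + - h r"
    "- h r + - h s = - h s + - h r"
    if "r < N" "s < N" for r s
  proof -
    show 1: "h r + h s = h s + h r" using comm that .
    show 2: "- h s + h r = h r + - h s"
      by (metis 1 add.assoc add.right_inverse add.left_inverse add_0 add.right_neutral)
    show 3: "- h r + h s = h s + - h r"
      by (metis 1 add.assoc add.right_inverse add.left_inverse add_0 add.right_neutral)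
    show "- h r + - h s = - h s + - h r"
      by (metis 1 minus_add)
  qed
  \<comment> \<open>Each side expands into four inner products of translates of \<xi>. For Q the
    sign of the adjoint occurs on both sides and cancels, so skew-adjointness serves as well as
    self-adjointness.\<close>
  have Psym: "L2_inner \<mu> (P r l) (P s l') = L2_inner \<mu> (P s l) (P r l')"
    and Qsym: "L2_inner \<mu> (Q r l) (Q s l') = L2_inner \<mu> (Q s l) (Q r l')"
    if "r < N" "s < N" "l < n" "l' < n" for r s l l'
    unfolding P_def Q_def using that comms[of r s]
    by (simp_all add: L2_inner_add L2_inner_diff L2_fun_add L2_fun_diff U L2_inner_left_regular[OF \<mu>] L2
        del: add_uminus_conv_diff)
  have sum_PQ: "(L2_norm \<mu> (P r l))\<^sup>2 + (L2_norm \<mu> (Q r l))\<^sup>2 = 4 * (L2_norm \<mu> (\<xi> l))\<^sup>2" if "l < n" for r l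
    unfolding P_def Q_def by (subst L2_parallelogram) (use U L2_norm_left_regular[OF \<mu>] L2 that in auto)
  have "4 * (\<Sum>k<n. (L2_norm \<mu> (\<lambda>t. \<Sum>l<n. \<Sum>r<N. complex_of_real (a r k l) * left_regular (y + h r) (\<xi> l) t))\<^sup>2)
      = (\<Sum>k<n. (L2_norm \<mu> (\<lambda>t. T P k t + T Q k t))\<^sup>2)"
    unfolding sum_distrib_left
  proof (intro sum.cong refl)
    fix k
    have eq: "(\<lambda>t. \<Sum>l<n. \<Sum>r<N. complex_of_real (a r k l) * left_regular (y + h r) (\<xi> l) t) =
       left_regular y (T (\<lambda>r l. left_regular (h r) (\<xi> l)) k)"
      unfolding T_def left_regular_add by (simp add: left_regular_def)
    have "L2_norm \<mu> (\<lambda>t. \<Sum>l<n. \<Sum>r<N. complex_of_real (a r k l) * left_regular (y + h r) (\<xi> l) t) =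
        L2_norm \<mu> (T (\<lambda>r l. left_regular (h r) (\<xi> l)) k)"
      unfolding eq by (rule L2_norm_left_regular[OF \<mu>]) (intro TL2 U)
    moreover have "(\<lambda>t. T P k t + T Q k t) = (\<lambda>t. 2 * T (\<lambda>r l. left_regular (h r) (\<xi> l)) k t)"
      unfolding T_def sum.distrib[symmetric] sum_distrib_left
      by (intro ext sum.cong refl) (simp add: P_def Q_def algebra_simps)
    ultimately show "4 * (L2_norm \<mu> (\<lambda>t. \<Sum>l<n. \<Sum>r<N. complex_of_real (a r k l) * left_regular (y + h r) (\<xi> l) t))\<^sup>2
        = (L2_norm \<mu> (\<lambda>t. T P k t + T Q k t))\<^sup>2"
      by (simp add: L2_norm_scale power_mult_distrib)
  qed
  also have "\<dots> \<le> (\<Sum>k<n. 2 * (L2_norm \<mu> (T P k))\<^sup>2 + 2 * (L2_norm \<mu> (T Q k))\<^sup>2)"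
    by (intro sum_mono L2_norm_add_squared_le TL2 PL2 QL2)
  also have "\<dots> = 2 * (\<Sum>k<n. (L2_norm \<mu> (T P k))\<^sup>2) + 2 * (\<Sum>k<n. (L2_norm \<mu> (T Q k))\<^sup>2)"
    by (simp add: sum.distrib sum_distrib_left)
  also have "\<dots> = 2 * (\<Sum>r<N. \<Sum>l<n. (L2_norm \<mu> (P r l))\<^sup>2) + 2 * (\<Sum>r<N. \<Sum>l<n. (L2_norm \<mu> (Q r l))\<^sup>2)"
    unfolding T_def
    using clifford_combination_norm[OF a PL2 Psym] clifford_combination_norm[OF a QL2 Qsym]
    by simp
  also have "\<dots> = 2 * (\<Sum>r<N. \<Sum>l<n. 4 * (L2_norm \<mu> (\<xi> l))\<^sup>2)"
    unfolding distrib_left[symmetric] sum.distrib[symmetric]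
    by (intro arg_cong[of _ _ "(*) 2"] sum.cong refl sum_PQ) auto
  also have "\<dots> = 4 * (2 * N * (\<Sum>l<n. (L2_norm \<mu> (\<xi> l))\<^sup>2))"
    by (simp add: sum_distrib_left)
  finally show ?thesis by simp
qed

subsection \<open>The duality between \<open>A(G)\<close> and \<open>VN(G)\<close>\<close>

text \<open>Every algebra in the intersection contains the translations and is closed under scalar
  multiples and sums. The induction starts at a single term because closure is stated for these two
  operations and not for the empty sum.\<close>

lemma group_vN_combination:
  assumes "finite I" "I \<noteq> {}"
  shows "(\<lambda>\<xi> t. \<Sum>i\<in>I. c i * left_regular (x i) \<xi> t) \<in> group_vN \<mu>"
proof -
  have "(\<lambda>\<xi> t. \<Sum>i\<in>I. c i * left_regular (x i) \<xi> t) \<in> M"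
    if M: "von_neumann_algebra \<mu> M" "range left_regular \<subseteq> M" for M
    using assms
  proof (induction I rule: finite_ne_induct)
    case (singleton i)
    have "left_regular (x i) \<in> M" using M by auto
    then show ?case using M(1) by (simp add: von_neumann_algebra_def)
  next
    case (insert i I)
    have "left_regular (x i) \<in> M" using M by auto
    then have "(\<lambda>\<xi> t. c i * left_regular (x i) \<xi> t) \<in> M"
      using M(1) unfolding von_neumann_algebra_def by blast
    moreover have "\<forall>S\<in>M. \<forall>T\<in>M. (\<lambda>\<xi> t. S \<xi> t + T \<xi> t) \<in> M"
      using M(1) unfolding von_neumann_algebra_def by blast
    ultimately show ?case
      using insert by simp
  qed
  then show ?thesis by (simp add: group_vN_def)
qed

lemma left_regular_in_group_vN: "left_regular s \<in> group_vN \<mu>"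
  by (auto simp: group_vN_def)

text \<open>This cruder relative of Cauchy-Schwarz fits the definition of a normal functional, where
  exactly the squares of the norms are summable.\<close>

lemma L2_inner_norm_le:
  assumes "f \<in> L2_fun \<mu>" "g \<in> L2_fun \<mu>"
  shows "cmod (L2_inner \<mu> f g) \<le> (L2_norm \<mu> f)\<^sup>2 + (L2_norm \<mu> g)\<^sup>2"
proof -
  have "cmod (L2_inner \<mu> f g) \<le> (\<integral>t. cmod (f t * cnj (g t)) \<partial>\<mu>)"
    unfolding L2_inner_def by (rule integral_norm_bound)
  also have "\<dots> \<le> (\<integral>t. (cmod (f t))\<^sup>2 + (cmod (g t))\<^sup>2 \<partial>\<mu>)"
  proof (rule integral_mono)
    show "cmod (f t * cnj (g t)) \<le> (cmod (f t))\<^sup>2 + (cmod (g t))\<^sup>2" for t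
      using sum_squares_bound[of "cmod (f t)" "cmod (g t)"]
        mult_nonneg_nonneg[OF norm_ge_zero norm_ge_zero, of "f t" "g t"]
      unfolding norm_mult complex_mod_cnj by linarith
    show "integrable \<mu> (\<lambda>t. cmod (f t * cnj (g t)))"
      using assms by (intro integrable_norm L2_inner_integrable)
  qed (use assms in \<open>auto simp: L2_fun_def\<close>)
  also have "\<dots> = (L2_norm \<mu> f)\<^sup>2 + (L2_norm \<mu> g)\<^sup>2"
    using assms by (simp add: L2_norm_squared L2_fun_def)
  finally show ?thesis .
qed

text \<open>Guarantees that the choice in \<open>fourier_pairing\<close> has a witness, namely T
  \<mapsto> \<langle>T\<xi>, \<eta>\<rangle>, with both vectors padded by zeros to
  sequences.\<close>

lemma fourier_functional_exists:
  assumes "f \<in> fourier_algebra \<mu>"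
  shows "\<exists>\<phi>. normal_functional \<mu> \<phi> \<and> (\<forall>s. \<phi> (left_regular s) = f s)"
proof -
  obtain \<xi> \<eta> where \<xi>: "\<xi> \<in> L2_fun \<mu>" and \<eta>: "\<eta> \<in> L2_fun \<mu>"
    and f: "f = (\<lambda>s. L2_inner \<mu> (left_regular s \<xi>) \<eta>)"
    using assms by (auto simp: fourier_algebra_def)
  define X where "X k = (if k = 0 then \<xi> else (\<lambda>t. 0))" for k :: nat
  define Y where "Y k = (if k = 0 then \<eta> else (\<lambda>t. 0))" for k :: nat
  have "normal_functional \<mu> (\<lambda>T. L2_inner \<mu> (T \<xi>) \<eta>)"
    unfolding normal_functional_def
  proof (intro exI conjI allI ballI)
    show "X k \<in> L2_fun \<mu>" "Y k \<in> L2_fun \<mu>" for k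
      using \<xi> \<eta> by (simp_all add: X_def Y_def L2_fun_zero)
    show "summable (\<lambda>k. (L2_norm \<mu> (X k))\<^sup>2)" "summable (\<lambda>k. (L2_norm \<mu> (Y k))\<^sup>2)"
      by (rule summable_finite[of "{0}"]; simp add: X_def Y_def L2_norm_def)+
    \<comment> \<open>For k > 0 the term vanishes because \<open>Y k\<close> is the zero function,
      whatever T does to \<open>X k\<close>.\<close>
    show "L2_inner \<mu> (T \<xi>) \<eta> = (\<Sum>k. L2_inner \<mu> (T (X k)) (Y k))" for T
      by (subst suminf_finite[of "{0}"]) (simp_all add: X_def Y_def L2_inner_def)
  qed
  then show ?thesis using f by auto
qed

text \<open>Whichever functional the choice operator picks, its series of inner products makes it
  linear on finite combinations of translations, and its values on translations are
  prescribed.\<close>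

lemma fourier_pairing_combination:
  assumes \<mu>: "left_haar_measure \<mu>" and f: "f \<in> fourier_algebra \<mu>" and "finite I" "I \<noteq> {}"
  shows "fourier_pairing \<mu> f (\<lambda>\<xi> t. \<Sum>i\<in>I. c i * left_regular (x i) \<xi> t) = (\<Sum>i\<in>I. c i * f (x i))"
proof -
  define \<phi> where "\<phi> = fourier_pairing \<mu> f"
  have \<phi>: "normal_functional \<mu> \<phi>" "\<And>s. \<phi> (left_regular s) = f s"
    using someI_ex[OF fourier_functional_exists[OF f]] by (simp_all add: \<phi>_def fourier_pairing_def)
  then obtain \<xi> \<eta> :: "nat \<Rightarrow> 'a \<Rightarrow> complex" where
    L2: "\<And>k. \<xi> k \<in> L2_fun \<mu>" "\<And>k. \<eta> k \<in> L2_fun \<mu>"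
    and summ: "summable (\<lambda>k. (L2_norm \<mu> (\<xi> k))\<^sup>2)" "summable (\<lambda>k. (L2_norm \<mu> (\<eta> k))\<^sup>2)"
    and eq: "\<And>T. T \<in> group_vN \<mu> \<Longrightarrow> \<phi> T = (\<Sum>k. L2_inner \<mu> (T (\<xi> k)) (\<eta> k))"
    unfolding normal_functional_def by blast
  have S: "summable (\<lambda>k. L2_inner \<mu> (left_regular s (\<xi> k)) (\<eta> k))" for s
  proof (rule summable_comparison_test[OF _ summable_add[OF summ]], intro exI allI impI)
    show "cmod (L2_inner \<mu> (left_regular s (\<xi> k)) (\<eta> k)) \<le> (L2_norm \<mu> (\<xi> k))\<^sup>2 + (L2_norm \<mu> (\<eta> k))\<^sup>2" for k
      using L2_inner_norm_le[OF L2_fun_left_regular[OF \<mu> L2(1)] L2(2)]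
      by (simp add: L2_norm_left_regular[OF \<mu> L2(1)])
  qed
  have "\<phi> (\<lambda>\<xi> t. \<Sum>i\<in>I. c i * left_regular (x i) \<xi> t)
      = (\<Sum>k. \<Sum>i\<in>I. c i * L2_inner \<mu> (left_regular (x i) (\<xi> k)) (\<eta> k))"
    by (subst eq[OF group_vN_combination[OF assms(3,4)]])
      (simp add: L2_inner_sum_left L2_inner_scale_left L2 L2_fun_scale L2_fun_left_regular[OF \<mu>])
  also have "\<dots> = (\<Sum>i\<in>I. \<Sum>k. c i * L2_inner \<mu> (left_regular (x i) (\<xi> k)) (\<eta> k))"
    by (intro suminf_sum summable_mult S)
  also have "\<dots> = (\<Sum>i\<in>I. c i * f (x i))"
    by (intro sum.cong refl, subst suminf_mult[OF S])
      (simp add: \<phi>(2)[symmetric] eq left_regular_in_group_vN)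
  finally show ?thesis by (simp add: \<phi>_def)
qed

section \<open>The lower bound for lifts of Clifford matrix functions\<close>

lemma clifford_operator_mat_norm:
  assumes "left_haar_measure \<mu>" "clifford_matrices N n a" "0 < N"
    and "\<And>r s. r < N \<Longrightarrow> s < N \<Longrightarrow> h r + h s = h s + h r"
  shows "operator_mat_norm \<mu> n
    (\<lambda>k l \<xi> t. \<Sum>r<N. complex_of_real (a r k l / sqrt (2 * N)) * left_regular (y + h r) \<xi> t) \<le> 1"
  unfolding operator_mat_norm_def
proof (intro SUP_least, elim CollectE conjE)
  fix \<xi> :: "nat \<Rightarrow> 'a \<Rightarrow> complex"
  assume \<xi>: "\<forall>l<n. \<xi> l \<in> L2_fun \<mu>" "L2_set (\<lambda>l. L2_norm \<mu> (\<xi> l)) {..<n} \<le> 1"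
  let ?F = "\<lambda>k t. \<Sum>l<n. \<Sum>r<N. complex_of_real (a r k l) * left_regular (y + h r) (\<xi> l) t"
  have "(\<lambda>t. \<Sum>l<n. \<Sum>r<N. complex_of_real (a r k l / sqrt (2 * N)) * left_regular (y + h r) (\<xi> l) t) =
      (\<lambda>t. complex_of_real (1 / sqrt (2 * N)) * ?F k t)" for k
    by (simp add: sum_distrib_left)
  then have "(\<Sum>k<n. (L2_norm \<mu> (\<lambda>t. \<Sum>l<n. \<Sum>r<N. complex_of_real (a r k l / sqrt (2 * N))
        * left_regular (y + h r) (\<xi> l) t))\<^sup>2) = (\<Sum>k<n. (L2_norm \<mu> (?F k))\<^sup>2) / (2 * N)"
    by (simp only: L2_norm_scale) (simp add: norm_divide power_divide sum_divide_distrib)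
  also have "\<dots> \<le> (\<Sum>l<n. (L2_norm \<mu> (\<xi> l))\<^sup>2)"
    using clifford_translation_norm[OF assms(1,2,4), where \<xi> = \<xi> and y = y] \<xi>(1) \<open>0 < N\<close>
    by (simp add: divide_le_eq mult.commute)
  also have "\<dots> \<le> 1"
    using \<xi>(2) by (simp add: L2_set_def)
  finally show "ennreal (L2_set (\<lambda>k. L2_norm \<mu> (\<lambda>t. \<Sum>l<n. \<Sum>r<N.
      complex_of_real (a r k l / sqrt (2 * N)) * left_regular (y + h r) (\<xi> l) t)) {..<n}) \<le> 1"
    by (simp add: L2_set_def)
qed

text \<open>The normalised Clifford operator matrix T is a contraction, and pairing f with it gives
  the matrix A = (\<Sum> a_r \<otimes> a_r) / sqrt(2N). Since each a_r is symmetric with square 1,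
  a_r \<otimes> a_r fixes the maximally entangled vector v, so v is an eigenvector of A with
  eigenvalue N / sqrt(2N) = sqrt(N/2).\<close>

lemma clifford_fourier_mat_norm_ge:
  assumes \<mu>: "left_haar_measure \<mu>" and a: "clifford_matrices N n a" and "0 < N" "0 < n"
    and comm: "\<And>r s. r < N \<Longrightarrow> s < N \<Longrightarrow> h r + h s = h s + h r"
    and f: "\<And>i j. i < n \<Longrightarrow> j < n \<Longrightarrow> f i j \<in> fourier_algebra \<mu>"
    and fa: "\<And>i j r. i < n \<Longrightarrow> j < n \<Longrightarrow> r < N \<Longrightarrow> f i j (y + h r) = complex_of_real (a r i j)"
  shows "ennreal (sqrt (N / 2)) \<le> fourier_mat_norm \<mu> n f"
proof -
  define T where "T k l = (\<lambda>\<xi> t. \<Sum>r<N. complex_of_real (a r k l / sqrt (2 * N)) * left_regular (y + h r) \<xi> t)"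
    for k l
  define A where "A = (\<lambda>(i, k) (j, l). fourier_pairing \<mu> (f i j) (T k l))"
  define v :: "nat \<times> nat \<Rightarrow> complex" where "v = (\<lambda>(j, l). if j = l then complex_of_real (1 / sqrt n) else 0)"
  let ?I = "{..<n} \<times> {..<n}"
  have N: "{..<N} \<noteq> {}" using \<open>0 < N\<close> by auto
  \<comment> \<open>Norm of c times the sum of the vectors e_j \<otimes> e_j; it serves both for v
    and for its image under A.\<close>
  have diag: "L2_set (\<lambda>p. cmod (if fst p = snd p then complex_of_real c else 0)) ?I = sqrt n * \<bar>c\<bar>" for c
  proof -
    have "(\<Sum>p\<in>?I. (cmod (if fst p = snd p then complex_of_real c else 0))\<^sup>2) =
        (\<Sum>i<n. \<Sum>j<n. if j = i then c\<^sup>2 else 0)"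
      by (subst sum.cartesian_product) (auto intro!: sum.cong)
    then show ?thesis by (simp add: L2_set_def real_sqrt_mult)
  qed
  have "L2_set (\<lambda>j. cmod (v j)) ?I = sqrt n * \<bar>1 / sqrt n\<bar>"
    using diag[of "1 / sqrt n"] by (simp add: v_def case_prod_unfold)
  then have v: "L2_set (\<lambda>j. cmod (v j)) ?I \<le> 1" using \<open>0 < n\<close> by simp
  \<comment> \<open>Only the entries of \<open>v\<close> with j = l are nonzero; transposing the
    second factor then turns the sum over j into an entry of the square of
    \<open>a r\<close>.\<close>
  have A: "(\<Sum>p\<in>?I. A (i, k) p * v p) =
      (if i = k then complex_of_real (N / (sqrt (2 * N) * sqrt n)) else 0)"
    if "i < n" "k < n" for i k
  proof -
    have "(\<Sum>p\<in>?I. A (i, k) p * v p) = (\<Sum>j<n. \<Sum>l<n. A (i, k) (j, l) * v (j, l))"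
      by (simp add: sum.cartesian_product)
    also have "\<dots> = (\<Sum>j<n. A (i, k) (j, j) / sqrt n)"
      by (simp add: v_def if_distrib[of "(*) _"] cong: if_cong)
    also have "\<dots> = (\<Sum>j<n. \<Sum>r<N. complex_of_real (a r i j * a r j k / (sqrt (2 * N) * sqrt n)))"
    proof (rule sum.cong[OF refl])
      fix j assume "j \<in> {..<n}"
      then have j: "j < n" by simp
      have "A (i, k) (j, j) = (\<Sum>r<N. complex_of_real (a r k j / sqrt (2 * N)) * f i j (y + h r))"
        unfolding A_def T_def prod.case
        by (rule fourier_pairing_combination[OF \<mu> f[OF that(1) j] _ N]) simp
      also have "\<dots> = (\<Sum>r<N. complex_of_real (a r j k / sqrt (2 * N)) * complex_of_real (a r i j))"
        using fa[OF that(1) j] clifford_matrices_sym[OF a, of _ k j] by simp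
      finally show "A (i, k) (j, j) / sqrt n =
          (\<Sum>r<N. complex_of_real (a r i j * a r j k / (sqrt (2 * N) * sqrt n)))"
        by (simp add: sum_divide_distrib mult.commute)
    qed
    also have "\<dots> = (\<Sum>r<N. complex_of_real ((\<Sum>j<n. a r i j * a r j k) / (sqrt (2 * N) * sqrt n)))"
      by (subst sum.swap) (simp add: sum_divide_distrib)
    also have "\<dots> = (\<Sum>r<N. if i = k then complex_of_real (1 / (sqrt (2 * N) * sqrt n)) else 0)"
      by (intro sum.cong refl) (simp add: clifford_matrices_square[OF a] that)
    finally show ?thesis by simp
  qed
  have "L2_set (\<lambda>p. cmod (\<Sum>q\<in>?I. A p q * v q)) ?I =
      L2_set (\<lambda>p. cmod (if fst p = snd p then complex_of_real (N / (sqrt (2 * N) * sqrt n)) else 0)) ?I"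
    by (intro L2_set_cong refl) (use A in auto)
  also have "\<dots> = sqrt (N / 2)"
  proof -
    have "real N / sqrt (2 * N) = sqrt (N / 2)"
      using \<open>0 < N\<close> by (simp add: real_sqrt_mult real_sqrt_divide field_simps)
    then show ?thesis unfolding diag using \<open>0 < n\<close> \<open>0 < N\<close> by (simp add: field_simps)
  qed
  finally have "ennreal (sqrt (N / 2)) = ennreal (L2_set (\<lambda>p. cmod (\<Sum>q\<in>?I. A p q * v q)) ?I)"
    by simp
  also have "\<dots> \<le> complex_mat_norm ?I A"
    unfolding complex_mat_norm_def by (rule SUP_upper) (use v in simp)
  also have "\<dots> \<le> fourier_mat_norm \<mu> n f"
    unfolding fourier_mat_norm_def A_def
  proof (rule SUP_upper2[of "(n, T)"])
    show "(n, T) \<in> {(m, T). (\<forall>k<m. \<forall>l<m. T k l \<in> group_vN \<mu>) \<and> operator_mat_norm \<mu> m T \<le> 1}"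
      unfolding mem_Collect_eq prod.case T_def
      by (intro conjI allI impI clifford_operator_mat_norm[OF \<mu> a \<open>0 < N\<close> comm]
          group_vN_combination[OF _ N]) auto
  qed simp
  finally show ?thesis .
qed

section \<open>The upper bound for subconvex combinations of Clifford matrices\<close>

lemma L2_set_sum_le: "L2_set (\<lambda>i. \<Sum>r\<in>R. f r i) I \<le> (\<Sum>r\<in>R. L2_set (f r) I)"
proof (induction R rule: infinite_finite_induct)
  case (insert r R)
  then show ?case
    using L2_set_triangle_ineq[of "f r" "\<lambda>i. \<Sum>r\<in>R. f r i" I] by simp
qed (simp_all add: L2_set_def)

text \<open>A real symmetric matrix with square 1 is orthogonal.\<close>

lemma clifford_matrices_isometry:
  assumes a: "clifford_matrices N n a" and r: "r < N"
  shows "L2_set (\<lambda>i. cmod (\<Sum>j<n. complex_of_real (a r i j) * v j)) {..<n} = L2_set (\<lambda>j. cmod (v j)) {..<n}"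
proof -
  have "complex_of_real (\<Sum>i<n. (cmod (\<Sum>j<n. complex_of_real (a r i j) * v j))\<^sup>2) =
      (\<Sum>i<n. \<Sum>j<n. \<Sum>k<n. of_real (a r j i * a r i k) * (v j * cnj (v k)))"
    unfolding of_real_sum complex_norm_square cnj_sum sum_product
    by (intro sum.cong refl) (use clifford_matrices_sym[OF a r] in \<open>simp add: mult_ac\<close>)
  also have "\<dots> = (\<Sum>j<n. \<Sum>k<n. \<Sum>i<n. of_real (a r j i * a r i k) * (v j * cnj (v k)))"
    by (subst sum.swap, rule sum.cong[OF refl], rule sum.swap)
  also have "\<dots> = (\<Sum>j<n. \<Sum>k<n. of_real (\<Sum>i<n. a r j i * a r i k) * (v j * cnj (v k)))"
    by (simp add: sum_distrib_right)
  also have "\<dots> = (\<Sum>j<n. \<Sum>k<n. if j = k then v j * cnj (v j) else 0)"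
    by (intro sum.cong refl) (simp add: clifford_matrices_square[OF a r])
  also have "\<dots> = complex_of_real (\<Sum>j<n. (cmod (v j))\<^sup>2)"
    by (simp add: complex_norm_square flip: of_real_power)
  finally show ?thesis by (simp only: of_real_eq_iff L2_set_def)
qed

text \<open>Triangle inequality for a combination of isometries whose nonnegative weights add up to
  at most 1.\<close>

lemma clifford_convex_combination_mat_norm:
  assumes a: "clifford_matrices N n a" and w: "\<And>r. r < N \<Longrightarrow> 0 \<le> w r" "(\<Sum>r<N. w r) \<le> 1"
  shows "complex_mat_norm {..<n} (\<lambda>i j. complex_of_real (\<Sum>r<N. w r * a r i j)) \<le> 1"
  unfolding complex_mat_norm_def
proof (intro SUP_least, elim CollectE)
  fix v :: "nat \<Rightarrow> complex" assume v: "L2_set (\<lambda>j. cmod (v j)) {..<n} \<le> 1"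
  let ?u = "\<lambda>r i. \<Sum>j<n. complex_of_real (a r i j) * v j"
  have "cmod (\<Sum>j<n. complex_of_real (\<Sum>r<N. w r * a r i j) * v j) \<le> (\<Sum>r<N. w r * cmod (?u r i))" for i
  proof -
    have "(\<Sum>j<n. complex_of_real (\<Sum>r<N. w r * a r i j) * v j) = (\<Sum>r<N. of_real (w r) * ?u r i)"
      by (simp add: sum_distrib_left sum_distrib_right mult.assoc) (rule sum.swap)
    also have "cmod \<dots> \<le> (\<Sum>r<N. cmod (of_real (w r) * ?u r i))"
      by (rule norm_sum)
    also have "\<dots> = (\<Sum>r<N. w r * cmod (?u r i))"
      by (intro sum.cong refl) (use w in \<open>simp add: norm_mult\<close>)
    finally show ?thesis .
  qed
  then have "L2_set (\<lambda>i. cmod (\<Sum>j<n. complex_of_real (\<Sum>r<N. w r * a r i j) * v j)) {..<n}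
      \<le> L2_set (\<lambda>i. \<Sum>r<N. w r * cmod (?u r i)) {..<n}"
    by (intro L2_set_mono) auto
  also have "\<dots> \<le> (\<Sum>r<N. L2_set (\<lambda>i. w r * cmod (?u r i)) {..<n})"
    by (rule L2_set_sum_le)
  also have "\<dots> = (\<Sum>r<N. w r * L2_set (\<lambda>j. cmod (v j)) {..<n})"
    by (intro sum.cong refl)
      (use w clifford_matrices_isometry[OF a] in \<open>simp add: L2_set_right_distrib[symmetric]\<close>)
  also have "\<dots> \<le> 1"
    using mult_mono[OF w(2) v] w by (simp add: sum_distrib_right[symmetric] sum_nonneg)
  finally show "ennreal (L2_set (\<lambda>i. cmod (\<Sum>j<n. complex_of_real (\<Sum>r<N. w r * a r i j) * v j)) {..<n}) \<le> 1"
    by simp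
qed

subsection \<open>Functions on \<open>E\<close>\<close>

text \<open>A locally compact Hausdorff space is completely regular, so x can be separated from the
  complement of a neighbourhood that avoids F and lies in a compact set.\<close>

lemma locally_compact_bump:
  fixes x :: "'a::t2_space"
  assumes "locally compact (UNIV :: 'a set)" "finite F" "x \<notin> F"
  shows "\<exists>f K. continuous_on UNIV f \<and> (\<forall>t. 0 \<le> f t \<and> f t \<le> (1::real)) \<and> f x = 1 \<and>
    (\<forall>t\<in>F. f t = 0) \<and> compact K \<and> (\<forall>t. t \<notin> K \<longrightarrow> f t = 0)"
proof -
  have nbhd: "\<exists>U V. open U \<and> compact V \<and> z \<in> U \<and> U \<subseteq> V \<and> V \<subseteq> W" if "open W" "z \<in> W" for z :: 'a and W
  proof -
    have "openin (top_of_set UNIV) W" using \<open>open W\<close> by simp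
    then have "\<exists>U V. openin (top_of_set UNIV) U \<and> compact V \<and> z \<in> U \<and> U \<subseteq> V \<and> V \<subseteq> W"
      using assms(1) \<open>z \<in> W\<close> unfolding locally_def by blast
    then show ?thesis by simp
  qed
  have "open (- F)" "x \<in> - F" using assms(2,3) by (auto intro: open_Compl finite_imp_closed)
  then obtain U V where UV: "open U" "compact V" "x \<in> U" "U \<subseteq> V" "V \<subseteq> - F"
    using nbhd[of "- F" x] by blast
  have "locally_compact_space (euclidean :: 'a topology)"
    unfolding locally_compact_space_def
  proof
    fix z :: 'a
    show "\<exists>U K. openin euclidean U \<and> compactin euclidean K \<and> z \<in> U \<and> U \<subseteq> K"
      using nbhd[of UNIV z] by auto
  qed
  moreover have "Hausdorff_space (euclidean :: 'a topology)"
    unfolding Hausdorff_space_def disjnt_def using hausdorff by auto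
  ultimately have reg: "completely_regular_space (euclidean :: 'a topology)"
    using locally_compact_regular_imp_completely_regular_space by blast
  have "openin euclidean U" using UV(1) by simp
  from completely_regular_space_gen_alt'[OF one_neq_zero, THEN iffD1, OF reg, rule_format, OF this UV(3)]
  obtain g :: "'a \<Rightarrow> real" where g: "continuous_map euclidean euclidean g" "g x = 1"
    "g ` (topspace euclidean - U) \<subseteq> {0}"
    by (elim exE conjE)
  \<comment> \<open>Clamping to [0,1] keeps the value 1 at x and the value 0 off U.\<close>
  let ?f = "\<lambda>t. max 0 (min 1 (g t))"
  have "continuous_on UNIV g" using g(1) by simp
  then have "continuous_on UNIV ?f" by (intro continuous_intros)
  moreover have "?f t = 0" if "t \<notin> U" for t
  proof -
    have "g t = 0" using g(3) that by auto
    then show ?thesis by simp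
  qed
  then have "\<forall>t\<in>F. ?f t = 0" "\<forall>t. t \<notin> V \<longrightarrow> ?f t = 0" using UV(4,5) by blast+
  ultimately show ?thesis
    using UV(2) g(2) by (intro exI[of _ ?f] exI[of _ V] conjI) auto
qed

text \<open>The bumps need not have disjoint supports: multiplying the \<open>r\<close>-th one by \<open>1 - \<psi> s\<close> for all
  \<open>s < r\<close> makes the sum telescope to \<open>1 - (\<Prod>s<N. 1 - \<psi> s)\<close>.\<close>

lemma locally_compact_subpartition_of_unity:
  fixes x :: "nat \<Rightarrow> 'a::t2_space"
  assumes lc: "locally compact (UNIV :: 'a set)" and x: "inj x"
  shows "\<exists>\<phi> K. (\<forall>r. continuous_on UNIV (\<phi> r)) \<and> (\<forall>r t. 0 \<le> \<phi> r t) \<and>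
    (\<forall>t. (\<Sum>r<N. \<phi> r t) \<le> (1::real)) \<and> (\<forall>r<N. \<forall>s<N. \<phi> r (x s) = (if r = s then 1 else 0)) \<and>
    compact K \<and> (\<forall>r<N. \<forall>t. t \<notin> K \<longrightarrow> \<phi> r t = 0)"
proof -
  define bump where "bump r f K \<longleftrightarrow> continuous_on UNIV f \<and> (\<forall>t. 0 \<le> f t \<and> f t \<le> (1::real)) \<and> f (x r) = 1 \<and>
    (\<forall>t\<in>x ` ({..<N} - {r}). f t = 0) \<and> compact K \<and> (\<forall>t. t \<notin> K \<longrightarrow> f t = 0)" for r f K
  have "\<exists>f K. bump r f K" for r
    unfolding bump_def using x by (intro locally_compact_bump[OF lc]) (auto simp: inj_eq)
  then obtain \<psi> K where bump: "\<And>r. bump r (\<psi> r) (K r)"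
    by metis
  then have cont: "\<And>r. continuous_on UNIV (\<psi> r)" and bd: "\<And>r t. 0 \<le> \<psi> r t" "\<And>r t. \<psi> r t \<le> 1"
      and one: "\<And>r. \<psi> r (x r) = 1" and zero: "\<And>r t. t \<in> x ` ({..<N} - {r}) \<Longrightarrow> \<psi> r t = 0"
      and K: "\<And>r. compact (K r)" "\<And>r t. t \<notin> K r \<Longrightarrow> \<psi> r t = 0"
    unfolding bump_def by blast+
  define \<phi> where "\<phi> r t = \<psi> r t * (\<Prod>s<r. 1 - \<psi> s t)" for r t
  have sum: "(\<Sum>r<n. \<phi> r t) = 1 - (\<Prod>s<n. 1 - \<psi> s t)" for n t
    by (induction n) (simp_all add: \<phi>_def algebra_simps)
  have "\<psi> r (x s) = 0" if "s < N" "r \<noteq> s" for r s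
    using that by (intro zero) auto
  \<comment> \<open>For r = s every factor of the product is 1, since the other bumps vanish at
    \<open>x s\<close>; for r \<noteq> s the leading factor \<open>\<psi> r\<close> vanishes
    there.\<close>
  then have delta: "\<phi> r (x s) = (if r = s then 1 else 0)" if "r < N" "s < N" for r s
    using that one by (auto simp: \<phi>_def)
  have cont_\<phi>: "continuous_on UNIV (\<phi> r)" for r
    unfolding \<phi>_def by (intro continuous_intros cont)
  have nonneg: "0 \<le> \<phi> r t" for r t
    unfolding \<phi>_def by (intro mult_nonneg_nonneg prod_nonneg) (use bd in auto)
  have le1: "(\<Sum>r<N. \<phi> r t) \<le> 1" for t
    unfolding sum using bd by (simp add: prod_nonneg)
  have compact: "compact (\<Union>r<N. K r)"
    by (intro compact_UN K) auto
  have supp: "\<phi> r t = 0" if "r < N" "t \<notin> (\<Union>r<N. K r)" for r t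
    using that K(2)[of t r] by (auto simp: \<phi>_def)
  show ?thesis
    by (intro exI[of _ \<phi>] exI[of _ "\<Union>r<N. K r"] conjI allI impI cont_\<phi> nonneg le1 delta compact supp)
qed

text \<open>Members of one class differ by a function vanishing on E, so the set of their
  restrictions is a singleton and \<open>the_elem\<close> returns the common restriction.\<close>

lemma fourier_quotient_member:
  assumes "F \<in> fourier_quotient \<mu> E" "f \<in> F"
  shows "f \<in> fourier_algebra \<mu>" "restrict f E = fourier_restriction E F"
proof -
  obtain g where g: "F = {(f, g) \<in> fourier_algebra \<mu> \<times> fourier_algebra \<mu>.
      (\<lambda>x. f x - g x) \<in> vanishing_ideal \<mu> E} `` {g}"
    using assms(1) unfolding fourier_quotient_def by (rule quotientE)
  show "f \<in> fourier_algebra \<mu>" using assms(2) g by auto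
  have "restrict f' E = restrict g E" if "f' \<in> F" for f'
    using that g by (auto simp: vanishing_ideal_def restrict_def)
  then have "(\<lambda>f. restrict f E) ` F = {restrict f E}"
    using assms(2) by auto
  then show "restrict f E = fourier_restriction E F"
    by (simp add: fourier_restriction_def)
qed

text \<open>The constant C must serve every matrix size, while the test matrices have size 2^N; this
  is where complete boundedness enters. A matrix function of norm at most 1 on E is shown to have
  only lifts of norm at least sqrt(N/2).\<close>

lemma cb_Helson_abelian_coset_bound:
  fixes x :: "nat \<Rightarrow> 'g::{topological_group_add,t2_space}" and N :: nat
  assumes lc: "locally compact (UNIV :: 'g set)" and \<mu>: "left_haar_measure \<mu>"
    and E: "closed E" "fourier_restriction E ` fourier_quotient \<mu> E = C0 E"
    and bound: "\<And>n h. (\<forall>i<n. \<forall>j<n. h i j \<in> C0 E) \<Longrightarrow> fourier_quotient_mat_norm \<mu> n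
      (\<lambda>i j. inv_into (fourier_quotient \<mu> E) (fourier_restriction E) (h i j))
        \<le> ennreal C * min_mat_norm E n h"
    and x: "inj x" "range x \<subseteq> E \<inter> (+) y ` H" and H: "abelian_subgroup H" and "0 < N"
  shows "ennreal (sqrt (N / 2)) \<le> ennreal C"
proof -
  define n :: nat where "n = 2 ^ N"
  obtain a where a: "clifford_matrices N n a"
    using clifford_matrices_exist[of N] by (auto simp: n_def)
  obtain \<phi> :: "nat \<Rightarrow> 'g \<Rightarrow> real" and K where \<phi>: "\<And>r. continuous_on UNIV (\<phi> r)" "\<And>r t. 0 \<le> \<phi> r t"
    "\<And>t. (\<Sum>r<N. \<phi> r t) \<le> 1" "\<And>r s. r < N \<Longrightarrow> s < N \<Longrightarrow> \<phi> r (x s) = (if r = s then 1 else 0)"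
    "compact K" "\<And>r t. r < N \<Longrightarrow> t \<notin> K \<Longrightarrow> \<phi> r t = 0"
    using locally_compact_subpartition_of_unity[OF lc x(1), of N] by blast
  define g where "g i j = restrict (\<lambda>t. complex_of_real (\<Sum>r<N. \<phi> r t * a r i j)) E" for i j
  define F where "F i j = inv_into (fourier_quotient \<mu> E) (fourier_restriction E) (g i j)" for i j
  have gC0: "g i j \<in> C0 E" for i j
    unfolding C0_def
  proof (intro CollectI conjI allI impI)
    show "g i j \<in> extensional E" by (simp add: g_def)
    have "continuous_on E (\<lambda>t. complex_of_real (\<Sum>r<N. \<phi> r t * a r i j))"
      by (intro continuous_intros continuous_on_subset[OF \<phi>(1)]) auto
    then show "continuous_on E (g i j)"
      by (simp add: g_def cong: continuous_on_cong)
    fix e :: real assume "e > 0"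
    have "compact (K \<inter> E)" using \<phi>(5) E(1) by (rule compact_Int_closed)
    moreover have "cmod (g i j t) < e" if "t \<in> E" "t \<notin> K" for t
      using that \<phi>(6) \<open>e > 0\<close> by (simp add: g_def)
    ultimately show "\<exists>K. compact K \<and> K \<subseteq> E \<and> (\<forall>x\<in>E - K. cmod (g i j x) < e)"
      by (intro exI[of _ "K \<inter> E"]) blast
  qed
  \<comment> \<open>Surjectivity of the restriction onto \<open>C0 E\<close> makes
    \<open>inv_into\<close> a right inverse, so \<open>F i j\<close> is a class that restricts to
    \<open>g i j\<close>.\<close>
  have F: "F i j \<in> fourier_quotient \<mu> E" "fourier_restriction E (F i j) = g i j" for i j
  proof -
    have "g i j \<in> fourier_restriction E ` fourier_quotient \<mu> E" using gC0 E(2) by simp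
    then show "F i j \<in> fourier_quotient \<mu> E" "fourier_restriction E (F i j) = g i j"
      unfolding F_def by (rule inv_into_into, rule f_inv_into_f)
  qed
  define h where "h r = - y + x r" for r
  have xh: "x r = y + h r" for r by (simp add: h_def)
  have "h r \<in> H" for r
  proof -
    have "x r \<in> (+) y ` H" using x(2) by auto
    then show ?thesis by (auto simp: h_def)
  qed
  then have comm: "h r + h s = h s + h r" for r s
    using H by (auto simp: abelian_subgroup_def)
  \<comment> \<open>The quotient norm is an infimum over all choices of representatives. Each choice
    agrees with \<open>g\<close> on E, in particular at the points \<open>x r\<close>, and so meets
    the lower bound.\<close>
  have "ennreal (sqrt (N / 2)) \<le> fourier_quotient_mat_norm \<mu> n F"
    unfolding fourier_quotient_mat_norm_def
  proof (rule INF_greatest, elim CollectE)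
    fix f assume f: "\<forall>i<n. \<forall>j<n. f i j \<in> F i j"
    show "ennreal (sqrt (N / 2)) \<le> fourier_mat_norm \<mu> n f"
    proof (rule clifford_fourier_mat_norm_ge[OF \<mu> a \<open>0 < N\<close> _ comm])
      show "0 < n" by (simp add: n_def)
      fix i j assume ij: "i < n" "j < n"
      then have fij: "f i j \<in> F i j" using f by blast
      show "f i j \<in> fourier_algebra \<mu>" by (rule fourier_quotient_member(1)[OF F(1) fij])
      fix r assume r: "r < N"
      have xE: "x r \<in> E" using x(2) by auto
      have "restrict (f i j) E = g i j"
        using fourier_quotient_member(2)[OF F(1) fij] F(2) by simp
      then have "f i j (x r) = g i j (x r)" using xE by (metis restrict_apply')
      also have "\<dots> = complex_of_real (\<Sum>s<N. \<phi> s (x r) * a s i j)"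
        using xE by (simp add: g_def)
      also have "(\<Sum>s<N. \<phi> s (x r) * a s i j) = (\<Sum>s<N. if s = r then a s i j else 0)"
        by (intro sum.cong refl) (simp add: \<phi>(4) r)
      finally show "f i j (y + h r) = complex_of_real (a r i j)"
        using r by (simp add: xh)
    qed
  qed
  also have "\<dots> \<le> ennreal C * min_mat_norm E n g"
    unfolding F_def by (rule bound) (use gC0 in blast)
  also have "\<dots> \<le> ennreal C * 1"
  proof (rule mult_left_mono)
    show "min_mat_norm E n g \<le> 1"
      unfolding min_mat_norm_def
    proof (rule SUP_least)
      fix t assume "t \<in> E"
      then have "(\<lambda>i j. g i j t) = (\<lambda>i j. complex_of_real (\<Sum>r<N. \<phi> r t * a r i j))"
        by (simp add: g_def)
      then show "complex_mat_norm {..<n} (\<lambda>i j. g i j t) \<le> 1"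
        using clifford_convex_combination_mat_norm[OF a, of "\<lambda>r. \<phi> r t"] \<phi>(2,3) by simp
    qed
  qed simp
  finally show ?thesis by simp
qed

theorem theorem3:
  fixes \<mu> :: "'g::{topological_group_add,t2_space} measure"
    and E :: "'g set" and H :: "nat \<Rightarrow> 'g set" and y :: "nat \<Rightarrow> 'g" and m :: nat
  assumes "locally compact (UNIV :: 'g set)"
    and "left_haar_measure \<mu>"
    and "cb_Helson_set \<mu> E"
    and "\<And>i. i \<in> {1..m} \<Longrightarrow> closed (H i) \<and> abelian_subgroup (H i)"
    and "E \<subseteq> (\<Union>i\<in>{1..m}. (+) (y i) ` H i)"
  shows "finite E"
proof (rule ccontr)
  assume "infinite E"
  \<comment> \<open>Pigeonhole: finitely many cosets cover the infinite set E.\<close>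
  have "\<exists>i\<in>{1..m}. infinite (E \<inter> (+) (y i) ` H i)"
  proof (rule ccontr)
    assume "\<not> ?thesis"
    then have "finite (\<Union>i\<in>{1..m}. E \<inter> (+) (y i) ` H i)" by blast
    moreover have "E \<subseteq> (\<Union>i\<in>{1..m}. E \<inter> (+) (y i) ` H i)" using assms(5) by blast
    ultimately show False using \<open>infinite E\<close> finite_subset by blast
  qed
  then obtain i where i: "i \<in> {1..m}" "infinite (E \<inter> (+) (y i) ` H i)" by blast
  then obtain x :: "nat \<Rightarrow> 'g" where x: "inj x" "range x \<subseteq> E \<inter> (+) (y i) ` H i"
    using infinite_countable_subset by blast
  have E: "closed E" "fourier_restriction E ` fourier_quotient \<mu> E = C0 E"
    using assms(3) unfolding cb_Helson_set_def by blast+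
  obtain C :: real where C: "\<And>n h. (\<forall>i<n. \<forall>j<n. h i j \<in> C0 E) \<Longrightarrow> fourier_quotient_mat_norm \<mu> n
      (\<lambda>i j. inv_into (fourier_quotient \<mu> E) (fourier_restriction E) (h i j))
        \<le> ennreal C * min_mat_norm E n h"
    using assms(3) unfolding cb_Helson_set_def completely_bounded_def by blast
  \<comment> \<open>Chosen so that sqrt(N/2) exceeds C. The maximum with 0 covers a negative C,
    which \<open>ennreal\<close> sends to 0.\<close>
  obtain N :: nat where N: "2 * (max 0 C)\<^sup>2 < N" using reals_Archimedean2 by blast
  have "0 \<le> 2 * (max 0 C)\<^sup>2" by simp
  with N have "0 < real N" by linarith
  then have "0 < N" by simp
  have "abelian_subgroup (H i)" using assms(4)[OF i(1)] by blast
  have "ennreal (sqrt (N / 2)) \<le> ennreal C"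
    by (rule cb_Helson_abelian_coset_bound[OF assms(1,2) E _ x \<open>abelian_subgroup (H i)\<close> \<open>0 < N\<close>])
      (rule C)
  also have "\<dots> \<le> ennreal (max 0 C)" by (intro ennreal_leI) simp
  finally have "sqrt (N / 2) \<le> max 0 C" by (subst (asm) ennreal_le_iff) simp_all
  then have "N / 2 \<le> (max 0 C)\<^sup>2" by (rule sqrt_le_D)
  with N show False by linarith
qed

end
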